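(* Let $\Gamma$ be a graph and, for $i=1,2,3$, let $(X_i,p_i,\Gamma)$ be an $F_i$-graph bundle over the same base $\Gamma$. Then the following hold. (1) Commutativity: $(X_1\boxplus X_2,(p_1,p_2),\Gamma)$ is equivalent to $(X_2\boxplus X_1,(p_2,p_1),\Gamma)$. (2) Associativity: $([X_1\boxplus X_2]\boxplus X_3,((p_1,p_2),p_3),\Gamma)$ is equivalent to $(X_1\boxplus[X_2\boxplus X_3],(p_1,(p_2,p_3)),\Gamma)$. (3) Existence of a neutral element: $(X_1,p_1,\Gamma)\boxplus(\Gamma,\mathrm{id},\Gamma)$ is equivalent to $(X_1,p_1,\Gamma)$.
   Context: Graphs are simple and undirected: $\Gamma=(V_\Gamma,E_\Gamma)$ with $E_\Gamma$ a set of unordered pairs of distinct vertices; $v\sim w$ means $\{v,w\}\in E_\Gamma$. A morphism of graphs $f:\Gamma_1\to\Gamma_2$ is a function $f:V_{\Gamma_1}\to V_{\Gamma_2}$ such that $v\sim w$ implies $f(v)\sim f(w)$ or $f(v)=f(w)$; it is surjective if it is surjective on vertices. An isomorphism of graphs is a bijection on vertices with $v\sim w$ iff $f(v)\sim f(w)$. The neighborhood $N(v)$ of a vertex $v$ is the graph with vertices $v$ and all $w\sim v$, and edges $\{v,w\}$ for $w\sim v$. For a natural number $k$, a triple $(\widetilde\Gamma,p,\Gamma)$ with $p:\widetilde\Gamma\to\Gamma$ a surjective morphism of graphs is a $k$-fold covering if each $p^{-1}(v)$ has exactly $k$ vertices and, for each vertex $x$ of $\widetilde\Gamma$, $p$ restricts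 to an isomorphism $N(x)\to N(p(x))$. For $v\sim w$ in $\Gamma$ the covering induces a bijection $\psi_{vw}:p^{-1}(v)\to p^{-1}(w)$ sending $x$ to the unique neighbour of $x$ in $\widetilde\Gamma$ lying over $w$. Graph bundles. Let $p:X\to\Gamma$ be a surjective morphism of graphs. The fiber $p^{-1}(v)$ is the subgraph of $X$ induced on the preimage of $v$. Let $\widetilde X$ be the graph with vertex set $V_X$ whose edges are the edges $\{x,y\}$ of $X$ with $p(x)\ne p(y)$, and let $\widetilde p:\widetilde X\to\Gamma$ be the map $p$. Given a graph $F$, $(X,p,\Gamma)$ is an $F$-graph bundle if (1) each fiber $p^{-1}(v)$ is isomorphic to $F$; (2) $\widetilde p:\widetilde X\to\Gamma$ is a $|V_F|$-fold covering; (3) for all $v\sim w$ in $\Gamma$ the bijection $\psi_{vw}:p^{-1}(v)\to p^{-1}(w)$ induced by this covering is an isomorphism of graphs. Two graph bundles $(X,p,\Gamma)$, $(Y,q,\Gamma)$ over the same base are equivalent if there is an isomorphism of graphs $\Phi:X\to Y$ with $q\circ\Phi=p$. $(\Gamma,\mathrm{id},\Gamma)$ is the graph bundle whose fiber is the one-vertex graph. Subdirect product. $(X_1,p_1,\Gamma)\boxplus(X_2,p_2,\Gamma)=(X_1\boxplus X_2,(p_1,p_2),\Gamma)$, where $X_1\boxplus X_2$ has vertex set $\{(x,y)\in V_{X_1}\times V_{X_2}:p_1(x)=p_2(y)\}$, and $(x,y)\sim(x',y')$ iff one of: (I) $x=x'$ and $y\sim y'$; (II) $x\sim x'$, $p_1(x)=p_1(x')$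 and $y=y'$; (III) $x\sim x'$, $p_1(x)\sim p_1(x')$ and $y\sim y'$; and $(p_1,p_2)(x,y)=p_1(x)=p_2(y)$. This is an $F_1\,\square\,F_2$-graph bundle over $\Gamma$, where $F_1\,\square\,F_2$ is the Cartesian product of graphs. *)

theory Defs
  imports Main
begin

record 'a graph =
  verts :: "'a set"
  edges :: "'a set set"

definition simple_graph :: "'a graph \<Rightarrow> bool" where
  "simple_graph G \<longleftrightarrow> (\<forall>e\<in>edges G. e \<subseteq> verts G \<and> card e = 2)"

definition adj :: "'a graph \<Rightarrow> 'a \<Rightarrow> 'a \<Rightarrow> bool" where
  "adj G v w \<longleftrightarrow> {v, w} \<in> edges G"

text \<open>
  Maps between graphs are total HOL functions; only their values on vertices matter.
\<close>

definition graph_morphism :: "('a \<Rightarrow> 'b) \<Rightarrow> 'a graph \<Rightarrow> 'b graph \<Rightarrow> bool" where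
  "graph_morphism f G H \<longleftrightarrow>
     simple_graph G \<and> simple_graph H \<and> f ` verts G \<subseteq> verts H \<and>
     (\<forall>v\<in>verts G. \<forall>w\<in>verts G. adj G v w \<longrightarrow> adj H (f v) (f w) \<or> f v = f w)"

definition surj_graph_morphism :: "('a \<Rightarrow> 'b) \<Rightarrow> 'a graph \<Rightarrow> 'b graph \<Rightarrow> bool" where
  "surj_graph_morphism f G H \<longleftrightarrow> graph_morphism f G H \<and> f ` verts G = verts H"

definition graph_iso :: "('a \<Rightarrow> 'b) \<Rightarrow> 'a graph \<Rightarrow> 'b graph \<Rightarrow> bool" where
  "graph_iso f G H \<longleftrightarrow>
     simple_graph G \<and> simple_graph H \<and> bij_betw f (verts G) (verts H) \<and>
     (\<forall>v\<in>verts G. \<forall>w\<in>verts G. adj G v w \<longleftrightarrow> adj H (f v) (f w))"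

definition isomorphic_graphs :: "'a graph \<Rightarrow> 'b graph \<Rightarrow> bool" where
  "isomorphic_graphs G H \<longleftrightarrow> (\<exists>f. graph_iso f G H)"

text \<open>
  The neighborhood is a star: edges between two neighbors of \<open>v\<close> are not part of it.
\<close>

definition nbhd :: "'a graph \<Rightarrow> 'a \<Rightarrow> 'a graph" where
  "nbhd G v = \<lparr>verts = insert v {w. adj G v w}, edges = {{v, w} | w. adj G v w}\<rparr>"

definition covering :: "nat \<Rightarrow> 'a graph \<Rightarrow> ('a \<Rightarrow> 'b) \<Rightarrow> 'b graph \<Rightarrow> bool" where
  "covering k Y p G \<longleftrightarrow>
     surj_graph_morphism p Y G \<and>
     (\<forall>v\<in>verts G. finite {x\<in>verts Y. p x = v} \<and> card {x\<in>verts Y. p x = v} = k) \<and>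
     (\<forall>x\<in>verts Y. graph_iso p (nbhd Y x) (nbhd G (p x)))"

text \<open>
  The bijection from the preimage of a vertex to the preimage of an adjacent vertex \<open>w\<close>
  which a covering induces.
\<close>

definition covering_bij :: "'a graph \<Rightarrow> ('a \<Rightarrow> 'b) \<Rightarrow> 'b \<Rightarrow> 'a \<Rightarrow> 'a" where
  "covering_bij Y p w x = (THE y. adj Y x y \<and> p y = w)"

definition fiber :: "'a graph \<Rightarrow> ('a \<Rightarrow> 'b) \<Rightarrow> 'b \<Rightarrow> 'a graph" where
  "fiber X p v = \<lparr>verts = {x\<in>verts X. p x = v}, edges = {e\<in>edges X. \<forall>x\<in>e. p x = v}\<rparr>"

definition nondegenerate_part :: "'a graph \<Rightarrow> ('a \<Rightarrow> 'b) \<Rightarrow> 'a graph" where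
  "nondegenerate_part X p =
     \<lparr>verts = verts X, edges = {{x, y} | x y. adj X x y \<and> p x \<noteq> p y}\<rparr>"

text \<open>
  The fiber \<open>F\<close> is finite, because the number of sheets of a covering is a natural number.
\<close>

definition graph_bundle_with_fiber ::
    "'f graph \<Rightarrow> 'a graph \<Rightarrow> ('a \<Rightarrow> 'b) \<Rightarrow> 'b graph \<Rightarrow> bool" where
  "graph_bundle_with_fiber F X p G \<longleftrightarrow>
     simple_graph F \<and> finite (verts F) \<and>
     surj_graph_morphism p X G \<and>
     (\<forall>v\<in>verts G. isomorphic_graphs (fiber X p v) F) \<and>
     covering (card (verts F)) (nondegenerate_part X p) p G \<and>
     (\<forall>v w. adj G v w \<longrightarrow>
        graph_iso (covering_bij (nondegenerate_part X p) p w) (fiber X p v) (fiber X p w))"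

text \<open>
  A graph bundle with unspecified fiber. Quantifying over fibers on the vertex type of the
  total graph loses nothing: if the base has a vertex, then the fiber over it can serve as
  \<open>F\<close>, and otherwise the empty graph can.
\<close>

definition graph_bundle :: "'a graph \<Rightarrow> ('a \<Rightarrow> 'b) \<Rightarrow> 'b graph \<Rightarrow> bool" where
  "graph_bundle X p G \<longleftrightarrow> (\<exists>F :: 'a graph. graph_bundle_with_fiber F X p G)"

text \<open>
  Equivalence of the graph bundles \<open>(X, p, G)\<close> and \<open>(Y, q, G)\<close>. Being a relation between
  graph bundles, it includes the requirement that both are graph bundles.
\<close>

definition bundle_equivalent ::
    "'b graph \<Rightarrow> 'a graph \<Rightarrow> ('a \<Rightarrow> 'b) \<Rightarrow> 'c graph \<Rightarrow> ('c \<Rightarrow> 'b) \<Rightarrow> bool" where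
  "bundle_equivalent G X p Y q \<longleftrightarrow>
     graph_bundle X p G \<and> graph_bundle Y q G \<and>
     (\<exists>\<Phi>. graph_iso \<Phi> X Y \<and> (\<forall>x\<in>verts X. q (\<Phi> x) = p x))"

text \<open>
  The adjacency condition of the subdirect product depends on the base graph \<open>G\<close>, so the base
  is an argument.
\<close>

definition subdirect_adj ::
    "'b graph \<Rightarrow> 'a graph \<Rightarrow> ('a \<Rightarrow> 'b) \<Rightarrow> 'c graph \<Rightarrow> 'a \<times> 'c \<Rightarrow> 'a \<times> 'c \<Rightarrow> bool" where
  "subdirect_adj G X p Y = (\<lambda>(x, y) (x', y').
     (x = x' \<and> adj Y y y') \<or>
     (adj X x x' \<and> p x = p x' \<and> y = y') \<or>
     (adj X x x' \<and> adj G (p x) (p x') \<and> adj Y y y'))"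

definition subdirect_product ::
    "'b graph \<Rightarrow> 'a graph \<Rightarrow> ('a \<Rightarrow> 'b) \<Rightarrow> 'c graph \<Rightarrow> ('c \<Rightarrow> 'b) \<Rightarrow> ('a \<times> 'c) graph" where
  "subdirect_product G X p Y q =
     (let V = {(x, y). x \<in> verts X \<and> y \<in> verts Y \<and> p x = q y}
      in \<lparr>verts = V, edges = {{a, b} | a b. a \<in> V \<and> b \<in> V \<and> subdirect_adj G X p Y a b}\<rparr>)"

text \<open>
  The projection \<open>(p, q)\<close> of the subdirect product; on its vertices, \<open>p x = q y\<close>.
\<close>

definition subdirect_proj :: "('a \<Rightarrow> 'b) \<Rightarrow> ('c \<Rightarrow> 'b) \<Rightarrow> 'a \<times> 'c \<Rightarrow> 'b" where
  "subdirect_proj p q = (\<lambda>(x, y). p x)"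

end

theory Submission
  imports Defs
begin

text \<open>
  For \<open>p : X \<rightarrow> \<Gamma>\<close> the covering condition says that edges of the base lift uniquely, and the
  condition on the bijections \<open>\<psi>\<close> says that lifting edges preserves and reflects adjacency
  inside fibers. In this form the conditions pass to the subdirect product componentwise, because
  an edge of the product over an edge of the base is a pair of lifts of that edge, while inside
  a fiber the product is the Cartesian product of the fibers. The three equivalences are the
  evident rearrangements of coordinates.
\<close>

section \<open>Graphs, isomorphisms, fibers and neighborhoods\<close>

lemma adj_sym: "adj G v w \<longleftrightarrow> adj G w v"
  by (simp add: adj_def insert_commute)

lemma simple_graph_iff:
  "simple_graph G \<longleftrightarrow>
     (\<forall>e\<in>edges G. \<exists>v w. e = {v, w} \<and> v \<noteq> w \<and> v \<in> verts G \<and> w \<in> verts G)"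
  unfolding simple_graph_def card_2_iff by (rule ball_cong) auto

lemma adj_simple:
  assumes "simple_graph G" "adj G v w"
  shows "v \<in> verts G" "w \<in> verts G" "v \<noteq> w"
  using assms by (auto simp: simple_graph_def adj_def)

lemma graph_iso_sym:
  assumes "graph_iso f G H"
  shows "graph_iso (inv_into (verts G) f) H G"
proof -
  have b: "bij_betw f (verts G) (verts H)" using assms by (simp add: graph_iso_def)
  have "\<And>v. v \<in> verts H \<Longrightarrow> f (inv_into (verts G) f v) = v"
    and "\<And>v. v \<in> verts H \<Longrightarrow> inv_into (verts G) f v \<in> verts G"
    using b by (auto simp: bij_betw_def f_inv_into_f inv_into_into)
  then show ?thesis
    using assms bij_betw_inv_into[OF b] by (auto simp: graph_iso_def)
qed

lemma graph_iso_trans: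
  assumes "graph_iso f G H" "graph_iso g H K"
  shows "graph_iso (g \<circ> f) G K"
  using assms bij_betw_trans[of f "verts G" "verts H" g "verts K"]
  by (auto simp: graph_iso_def bij_betwE)

lemma isomorphic_graphs_sym: "isomorphic_graphs G H \<Longrightarrow> isomorphic_graphs H G"
  unfolding isomorphic_graphs_def using graph_iso_sym by blast

lemma isomorphic_graphs_trans:
  "isomorphic_graphs G H \<Longrightarrow> isomorphic_graphs H K \<Longrightarrow> isomorphic_graphs G K"
  unfolding isomorphic_graphs_def using graph_iso_trans by blast

lemma isomorphic_graphs_card:
  assumes "isomorphic_graphs G H"
  shows "card (verts G) = card (verts H)" "finite (verts G) \<longleftrightarrow> finite (verts H)"
  using assms bij_betw_same_card bij_betw_finite
  unfolding isomorphic_graphs_def graph_iso_def by blast+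

lemma verts_fiber [simp]: "verts (fiber X p v) = {x \<in> verts X. p x = v}"
  by (simp add: fiber_def)

lemma adj_fiber [simp]: "adj (fiber X p v) x y \<longleftrightarrow> adj X x y \<and> p x = v \<and> p y = v"
  by (auto simp: fiber_def adj_def)

lemma simple_graph_fiber: "simple_graph X \<Longrightarrow> simple_graph (fiber X p v)"
  by (auto simp: simple_graph_def fiber_def)

lemma verts_nondegenerate_part [simp]: "verts (nondegenerate_part X p) = verts X"
  by (simp add: nondegenerate_part_def)

lemma adj_nondegenerate_part [simp]:
  "adj (nondegenerate_part X p) x y \<longleftrightarrow> adj X x y \<and> p x \<noteq> p y"
  by (auto simp: nondegenerate_part_def adj_def doubleton_eq_iff insert_commute)

lemma simple_graph_nondegenerate_part:
  "simple_graph X \<Longrightarrow> simple_graph (nondegenerate_part X p)"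
  unfolding simple_graph_def by (auto simp: nondegenerate_part_def adj_def)

lemma verts_nbhd [simp]: "verts (nbhd G v) = insert v {w. adj G v w}"
  by (simp add: nbhd_def)

lemma adj_nbhd [simp]:
  "adj (nbhd G v) a b \<longleftrightarrow> a = v \<and> adj G v b \<or> b = v \<and> adj G v a"
  by (auto simp: nbhd_def adj_def doubleton_eq_iff)

lemma simple_graph_nbhd:
  assumes "simple_graph G"
  shows "simple_graph (nbhd G v)"
  unfolding simple_graph_iff using adj_simple(3)[OF assms] by (force simp: nbhd_def)

section \<open>Graph bundles in terms of edge lifting\<close>

definition unique_edge_lifting :: "'a graph \<Rightarrow> ('a \<Rightarrow> 'b) \<Rightarrow> 'b graph \<Rightarrow> bool" where
  "unique_edge_lifting X p G \<longleftrightarrow>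
     (\<forall>x\<in>verts X. \<forall>w. adj G (p x) w \<longrightarrow> (\<exists>!y. adj X x y \<and> p y = w))"

text \<open>Speaking of pairs of edges over the same base edge, instead of values of
  \<open>covering_bij\<close>, avoids the definite description. Here \<open>x\<close> and
  \<open>y\<close> share a fiber, and \<open>x'\<close> and \<open>y'\<close> are the other ends of
  the edges that start there.\<close>

definition lifting_respects_fibers :: "'a graph \<Rightarrow> ('a \<Rightarrow> 'b) \<Rightarrow> 'b graph \<Rightarrow> bool" where
  "lifting_respects_fibers X p G \<longleftrightarrow>
     (\<forall>x y x' y'. adj G (p x) (p x') \<and> p y = p x \<and> p y' = p x' \<and> adj X x x' \<and> adj X y y'
        \<longrightarrow> (adj X x y \<longleftrightarrow> adj X x' y'))"

lemma unique_edge_lifting_ex: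
  assumes "unique_edge_lifting X p G" "x \<in> verts X" "adj G (p x) w"
  obtains y where "adj X x y" "p y = w"
  using assms unfolding unique_edge_lifting_def by blast

lemma unique_edge_lifting_unique:
  assumes "unique_edge_lifting X p G" "x \<in> verts X" "adj G (p x) (p y)"
    and "adj X x y" "adj X x y'" "p y' = p y"
  shows "y = y'"
  using assms unfolding unique_edge_lifting_def by blast

text \<open>Both neighborhoods are stars, and \<open>p\<close> sends center to center, so adjacency
  takes care of itself once \<open>p\<close> is a bijection on vertices. On the leaves, surjectivity
  is existence of lifts and injectivity is their uniqueness. The right side can use edges of
  \<open>X\<close> itself: the base has no loops, so an edge lying over an edge of the base is
  nondegenerate.\<close>

lemma graph_iso_nbhd_iff:
  assumes "surj_graph_morphism p X G" "x \<in> verts X"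
  shows "graph_iso p (nbhd (nondegenerate_part X p) x) (nbhd G (p x)) \<longleftrightarrow>
           (\<forall>w. adj G (p x) w \<longrightarrow> (\<exists>!y. adj X x y \<and> p y = w))"
    (is "?L \<longleftrightarrow> ?R")
proof -
  have sX: "simple_graph X" and sG: "simple_graph G"
    and mor: "\<And>y. adj X x y \<Longrightarrow> adj G (p x) (p y) \<or> p x = p y"
    using assms adj_simple[of X]
    by (auto simp: surj_graph_morphism_def graph_morphism_def)
  let ?A = "{y. adj X x y \<and> p x \<noteq> p y}" and ?B = "{w. adj G (p x) w}"
  show ?thesis
  proof
    assume ?L
    then have b: "bij_betw p (insert x ?A) (insert (p x) ?B)"
      by (simp add: graph_iso_def)
    show ?R
    proof (intro allI impI)
      fix w assume w: "adj G (p x) w"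
      \<comment> \<open>This keeps the center \<open>x\<close> from being the preimage of
        \<open>w\<close> in the star, so a leaf must be.\<close>
      then have "p x \<noteq> w" using adj_simple(3)[OF sG] by blast
      moreover have "w \<in> p ` insert x ?A"
        using w b unfolding bij_betw_def by blast
      ultimately obtain y where y: "adj X x y" "p y = w" by blast
      moreover have "z = y" if "adj X x z" "p z = w" for z
        using bij_betw_imp_inj_on[OF b] that y \<open>p x \<noteq> w\<close> unfolding inj_on_def by auto
      ultimately show "\<exists>!y. adj X x y \<and> p y = w" by blast
    qed
  next
    assume R: ?R
    \<comment> \<open>Leaves with equal image are lifts of the same base edge, by
      \<open>mor\<close>; a leaf and the center differ in image by the definition of
      \<open>?A\<close>.\<close>
    have "inj_on p (insert x ?A)"
      unfolding inj_on_def using R mor by fastforce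
    moreover have "p ` insert x ?A = insert (p x) ?B"
    proof -
      have "w \<in> p ` ?A" if "w \<in> ?B" for w
      proof -
        from that R obtain y where "adj X x y" "p y = w" by blast
        then show ?thesis using that adj_simple(3)[OF sG, of "p x" w] by auto
      qed
      then show ?thesis using mor by auto
    qed
    ultimately have "bij_betw p (insert x ?A) (insert (p x) ?B)"
      by (simp add: bij_betw_def)
    moreover have
      "adj (nbhd (nondegenerate_part X p) x) a b \<longleftrightarrow> adj (nbhd G (p x)) (p a) (p b)"
      if "a \<in> insert x ?A" "b \<in> insert x ?A" for a b
      using that mor adj_simple(3)[OF sG] adj_simple(3)[OF sX] by auto
    ultimately show ?L
      using simple_graph_nbhd[OF sG]
        simple_graph_nbhd[OF simple_graph_nondegenerate_part[OF sX]]
      by (simp add: graph_iso_def)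
  qed
qed

lemma covering_iff:
  assumes "surj_graph_morphism p X G"
  shows "covering k (nondegenerate_part X p) p G \<longleftrightarrow>
           (\<forall>v\<in>verts G. finite {x\<in>verts X. p x = v} \<and> card {x\<in>verts X. p x = v} = k) \<and>
           unique_edge_lifting X p G"
proof -
  \<comment> \<open>Removing the edges inside fibers leaves the vertices in place, so
    \<open>p\<close> remains a surjective morphism.\<close>
  have "surj_graph_morphism p (nondegenerate_part X p) G"
    using assms simple_graph_nondegenerate_part[of X p]
    unfolding surj_graph_morphism_def graph_morphism_def by auto
  then show ?thesis
    using graph_iso_nbhd_iff[OF assms] by (auto simp: covering_def unique_edge_lifting_def)
qed

text \<open>Any lift found by other means may serve as the value of the definite description,
  because lifts are unique.\<close>

lemma covering_bij_eq:
  assumes "simple_graph G" "unique_edge_lifting X p G" "x \<in> verts X"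
    and "adj G (p x) w" "adj X x y" "p y = w"
  shows "covering_bij (nondegenerate_part X p) p w x = y"
  unfolding covering_bij_def
proof (rule the_equality)
  show "adj (nondegenerate_part X p) x y \<and> p y = w"
    using assms adj_simple(3)[OF assms(1,4)] by simp
next
  fix z assume "adj (nondegenerate_part X p) x z \<and> p z = w"
  then show "z = y"
    using unique_edge_lifting_unique[OF assms(2,3), of y z] assms by auto
qed

text \<open>Lifting an edge and then lifting its reverse leads back to the start, so unique lifting
  already makes each \<psi> a bijection. What remains of the isomorphism condition is that adjacency
  inside fibers is preserved and reflected.\<close>

lemma graph_iso_covering_bij_iff:
  assumes surj: "surj_graph_morphism p X G" and lift: "unique_edge_lifting X p G"
  shows "(\<forall>v w. adj G v w \<longrightarrow>
            graph_iso (covering_bij (nondegenerate_part X p) p w) (fiber X p v) (fiber X p w))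
         \<longleftrightarrow> lifting_respects_fibers X p G"
    (is "?L \<longleftrightarrow> ?R")
proof -
  have sX: "simple_graph X" and sG: "simple_graph G"
    using surj by (auto simp: surj_graph_morphism_def graph_morphism_def)
  let ?\<psi> = "covering_bij (nondegenerate_part X p) p"
  show ?thesis
  proof
    assume L: ?L
    show ?R
      unfolding lifting_respects_fibers_def
    proof (intro allI impI, elim conjE)
      fix x y x' y'
      assume a: "adj G (p x) (p x')" "p y = p x" "p y' = p x'" "adj X x x'" "adj X y y'"
      have V: "x \<in> verts X" "y \<in> verts X"
        using a adj_simple[OF sX] by blast+
      have "?\<psi> (p x') x = x'" "?\<psi> (p x') y = y'"
        using covering_bij_eq[OF sG lift] a V by simp_all
      then show "adj X x y \<longleftrightarrow> adj X x' y'"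
        using L[rule_format, OF a(1)] V a unfolding graph_iso_def by auto
    qed
  next
    assume R: ?R
    show ?L
    proof (intro allI impI)
      fix v w assume vw: "adj G v w"
      then have wv: "adj G w v" by (simp add: adj_sym)
      let ?A = "{x \<in> verts X. p x = v}" and ?B = "{x \<in> verts X. p x = w}"
      \<comment> \<open>Stated for an arbitrary oriented base edge from \<open>a\<close> to
        \<open>b\<close>, in order to apply to both \<open>v\<close>, \<open>w\<close> and
        \<open>w\<close>, \<open>v\<close>: the two maps are then mutually inverse.\<close>
      have \<psi>: "adj X x (?\<psi> b x) \<and> p (?\<psi> b x) = b \<and> ?\<psi> b x \<in> verts X
          \<and> ?\<psi> a (?\<psi> b x) = x"
        if xab: "x \<in> verts X" "p x = a" "adj G a b" for x a b
      proof -
        obtain y where y: "adj X x y" "p y = b"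
          using unique_edge_lifting_ex[OF lift, of x b] xab by auto
        have "y \<in> verts X" using adj_simple[OF sX y(1)] by blast
        have "?\<psi> b x = y" using covering_bij_eq[OF sG lift] xab y by simp
        moreover have "?\<psi> a y = x"
          using covering_bij_eq[OF sG lift \<open>y \<in> verts X\<close>] xab y by (simp add: adj_sym)
        ultimately show ?thesis using y \<open>y \<in> verts X\<close> by simp
      qed
      have "bij_betw (?\<psi> w) ?A ?B"
        by (rule bij_betw_byWitness[where f' = "?\<psi> v"]) (use \<psi> vw wv in auto)
      moreover have "adj (fiber X p v) x y \<longleftrightarrow> adj (fiber X p w) (?\<psi> w x) (?\<psi> w y)"
        if "x \<in> ?A" "y \<in> ?A" for x y
      proof -
        have x: "adj X x (?\<psi> w x)" "p (?\<psi> w x) = w" and y: "adj X y (?\<psi> w y)" "p (?\<psi> w y) = w"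
          using \<psi> that vw by auto
        then have "adj X x y \<longleftrightarrow> adj X (?\<psi> w x) (?\<psi> w y)"
          using R[unfolded lifting_respects_fibers_def, rule_format, of x "?\<psi> w x" y "?\<psi> w y"]
            that vw by simp
        then show ?thesis using x y that by simp
      qed
      ultimately show "graph_iso (?\<psi> w) (fiber X p v) (fiber X p w)"
        by (simp add: graph_iso_def simple_graph_fiber sX)
    qed
  qed
qed

text \<open>The working form of the bundle conditions. The number of sheets needs no separate
  mention, since an isomorphism of each fiber with the finite graph \<open>F\<close> fixes it; the
  covering condition thus shrinks to unique lifting.\<close>

lemma graph_bundle_with_fiber_iff:
  "graph_bundle_with_fiber F X p G \<longleftrightarrow>
     simple_graph F \<and> finite (verts F) \<and> surj_graph_morphism p X G \<and>
     (\<forall>v\<in>verts G. isomorphic_graphs (fiber X p v) F) \<and>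
     unique_edge_lifting X p G \<and> lifting_respects_fibers X p G"
proof -
  have cov: "covering (card (verts F)) (nondegenerate_part X p) p G \<longleftrightarrow>
      unique_edge_lifting X p G"
    if "finite (verts F)" "surj_graph_morphism p X G"
      "\<forall>v\<in>verts G. isomorphic_graphs (fiber X p v) F"
  proof -
    have "finite {x\<in>verts X. p x = v} \<and> card {x\<in>verts X. p x = v} = card (verts F)"
      if "v \<in> verts G" for v
      using isomorphic_graphs_card[of "fiber X p v" F] \<open>finite (verts F)\<close>
        \<open>\<forall>v\<in>verts G. isomorphic_graphs (fiber X p v) F\<close> that by simp
    then show ?thesis using covering_iff[OF that(2)] by simp
  qed
  show ?thesis
    unfolding graph_bundle_with_fiber_def
    \<comment> \<open>\<open>conj_cong\<close> makes the earlier conjuncts available as hypotheses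
      for rewriting the later ones.\<close>
    by (intro conj_cong refl) (simp_all add: cov graph_iso_covering_bij_iff)
qed

lemma graph_bundle_with_fiber_simple:
  assumes "graph_bundle_with_fiber F X p G"
  shows "simple_graph X" "simple_graph G"
  using assms
  by (auto simp: graph_bundle_with_fiber_iff surj_graph_morphism_def graph_morphism_def)

lemma graph_bundle_with_fiber_proj:
  assumes "graph_bundle_with_fiber F X p G"
  shows "p ` verts X = verts G"
    and "\<And>x y. adj X x y \<Longrightarrow> adj G (p x) (p y) \<or> p x = p y"
  using assms graph_bundle_with_fiber_simple[OF assms] adj_simple[of X]
  by (auto simp: graph_bundle_with_fiber_iff surj_graph_morphism_def graph_morphism_def)

text \<open>Bridges a change of type: \<open>F\<close> may have any vertex type, whereas
  \<open>graph_bundle\<close>, and with it \<open>bundle_equivalent\<close>, wants a fiber on the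
  vertex type of the total graph. Since all fibers are isomorphic to \<open>F\<close>, any one of
  them can replace it.\<close>

lemma graph_bundle_if_graph_bundle_with_fiber:
  fixes X :: "'a graph"
  assumes X: "graph_bundle_with_fiber F X p G"
  shows "graph_bundle X p G"
proof -
  have F: "\<forall>v\<in>verts G. isomorphic_graphs (fiber X p v) F" "finite (verts F)"
    using X by (auto simp: graph_bundle_with_fiber_iff)
  have "\<exists>F'::'a graph. simple_graph F' \<and> finite (verts F') \<and>
          (\<forall>v\<in>verts G. isomorphic_graphs (fiber X p v) F')"
  proof (cases "verts G = {}")
    case True
    then show ?thesis
      by (intro exI[of _ "\<lparr>verts = {}, edges = {}\<rparr>"]) (simp add: simple_graph_def)
  next
    case False
    then obtain v where v: "v \<in> verts G" by blast
    have "simple_graph (fiber X p v)"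
      by (rule simple_graph_fiber[OF graph_bundle_with_fiber_simple(1)[OF X]])
    moreover have "finite (verts (fiber X p v))"
      using isomorphic_graphs_card(2)[OF F(1)[rule_format, OF v]] F(2) by blast
    moreover have "\<forall>w\<in>verts G. isomorphic_graphs (fiber X p w) (fiber X p v)"
      using F(1) v isomorphic_graphs_sym isomorphic_graphs_trans by blast
    ultimately show ?thesis by blast
  qed
  then show ?thesis
    using X unfolding graph_bundle_def graph_bundle_with_fiber_iff by blast
qed

section \<open>Subdirect products are bundles with Cartesian products as fibers\<close>

definition cartesian_product :: "'a graph \<Rightarrow> 'b graph \<Rightarrow> ('a \<times> 'b) graph" where
  "cartesian_product G H =
     \<lparr>verts = verts G \<times> verts H,
      edges = {{(x, y), (x', y')} | x y x' y'.
        x = x' \<and> x \<in> verts G \<and> adj H y y' \<or> adj G x x' \<and> y = y' \<and> y \<in> verts H}\<rparr>"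

lemma verts_cartesian_product [simp]:
  "verts (cartesian_product G H) = verts G \<times> verts H"
  by (simp add: cartesian_product_def)

lemma adj_cartesian_product [simp]:
  "adj (cartesian_product G H) (x, y) (x', y') \<longleftrightarrow>
     x = x' \<and> x \<in> verts G \<and> adj H y y' \<or> adj G x x' \<and> y = y' \<and> y \<in> verts H"
  by (auto simp: cartesian_product_def adj_def doubleton_eq_iff insert_commute)

lemma simple_graph_cartesian_product:
  assumes "simple_graph G" "simple_graph H"
  shows "simple_graph (cartesian_product G H)"
  unfolding simple_graph_iff
  using adj_simple[OF assms(1)] adj_simple[OF assms(2)]
  by (fastforce simp: cartesian_product_def)

lemma verts_subdirect_product [simp]:
  "verts (subdirect_product G X p Y q) = {(x, y). x \<in> verts X \<and> y \<in> verts Y \<and> p x = q y}"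
  by (simp add: subdirect_product_def)

lemma subdirect_proj_simp [simp]: "subdirect_proj p q (x, y) = p x"
  by (simp add: subdirect_proj_def)

lemma adj_subdirect_product [simp]:
  "adj (subdirect_product G X p Y q) (x, y) (x', y') \<longleftrightarrow>
     x \<in> verts X \<and> y \<in> verts Y \<and> p x = q y \<and> x' \<in> verts X \<and> y' \<in> verts Y \<and> p x' = q y' \<and>
     (x = x' \<and> adj Y y y' \<or> adj X x x' \<and> p x = p x' \<and> y = y' \<or>
      adj X x x' \<and> adj G (p x) (p x') \<and> adj Y y y')"
proof -
  \<comment> \<open>Edges are unordered pairs, so an edge might stem from either order of its ends;
    symmetry makes both orders say the same.\<close>
  have "subdirect_adj G X p Y a b \<longleftrightarrow> subdirect_adj G X p Y b a" for a b
    by (auto simp: subdirect_adj_def adj_sym split: prod.splits)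
  then have "adj (subdirect_product G X p Y q) a b \<longleftrightarrow>
      a \<in> verts (subdirect_product G X p Y q) \<and> b \<in> verts (subdirect_product G X p Y q) \<and>
      subdirect_adj G X p Y a b" for a b
    by (auto simp: adj_def subdirect_product_def Let_def doubleton_eq_iff simp del: split_paired_All)
  then show ?thesis by (auto simp: subdirect_adj_def)
qed

lemma simple_graph_subdirect_product:
  assumes "simple_graph X" "simple_graph Y"
  shows "simple_graph (subdirect_product G X p Y q)"
  unfolding simple_graph_iff
  using adj_simple(3)[OF assms(1)] adj_simple(3)[OF assms(2)]
  by (fastforce simp: subdirect_product_def Let_def subdirect_adj_def)

text \<open>Within a fiber the third kind of edge would need a loop in the base. The two other kinds
  are the two kinds of edges of a Cartesian product, so the product of the two fiber isomorphisms
  works.\<close>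

lemma fiber_subdirect_product_isomorphic:
  assumes "simple_graph X" "simple_graph Y" "simple_graph G"
    and "isomorphic_graphs (fiber X p v) F" "isomorphic_graphs (fiber Y q v) F'"
  shows "isomorphic_graphs (fiber (subdirect_product G X p Y q) (subdirect_proj p q) v)
           (cartesian_product F F')"
proof -
  obtain f g where f: "graph_iso f (fiber X p v) F" and g: "graph_iso g (fiber Y q v) F'"
    using assms by (auto simp: isomorphic_graphs_def)
  let ?P = "fiber (subdirect_product G X p Y q) (subdirect_proj p q) v"
  let ?A = "{x \<in> verts X. p x = v}" and ?B = "{y \<in> verts Y. q y = v}"
  have bf: "bij_betw f ?A (verts F)" and bg: "bij_betw g ?B (verts F')"
    and sF: "simple_graph F" and sF': "simple_graph F'"
    using f g by (auto simp: graph_iso_def)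
  have vP: "verts ?P = ?A \<times> ?B" by auto
  have "bij_betw (map_prod f g) (verts ?P) (verts (cartesian_product F F'))"
    unfolding vP verts_cartesian_product by (rule bij_betw_map_prod[OF bf bg])
  moreover have "adj ?P a b \<longleftrightarrow> adj (cartesian_product F F') (map_prod f g a) (map_prod f g b)"
    if ab: "a \<in> verts ?P" "b \<in> verts ?P" for a b
  proof -
    obtain x y x' y' where eq: "a = (x, y)" "b = (x', y')" by fastforce
    then have V: "x \<in> ?A" "x' \<in> ?A" "y \<in> ?B" "y' \<in> ?B" using ab by auto
    have "adj X x x' \<longleftrightarrow> adj F (f x) (f x')" "adj Y y y' \<longleftrightarrow> adj F' (g y) (g y')"
      using f g V by (auto simp: graph_iso_def)
    \<comment> \<open>Cartesian adjacency also compares coordinates for equality, which injectivity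
      carries over.\<close>
    moreover have "x = x' \<longleftrightarrow> f x = f x'" "y = y' \<longleftrightarrow> g y = g y'"
      using V bij_betw_imp_inj_on[OF bf] bij_betw_imp_inj_on[OF bg] by (auto simp: inj_on_eq_iff)
    moreover have "f x \<in> verts F" "g y \<in> verts F'"
      using V bf bg by (blast dest: bij_betwE)+
    moreover have "\<not> adj G v v" using adj_simple(3)[OF assms(3)] by blast
    ultimately show ?thesis using V eq by auto
  qed
  ultimately have "graph_iso (map_prod f g) ?P (cartesian_product F F')"
    by (simp add: graph_iso_def simple_graph_cartesian_product simple_graph_fiber
        simple_graph_subdirect_product sF sF' assms(1,2))
  then show ?thesis by (auto simp: isomorphic_graphs_def)
qed

text \<open>Needed for all three equivalences, because \<open>bundle_equivalent\<close> requires
  both of its arguments to be bundles.\<close>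

proposition graph_bundle_with_fiber_subdirect_product:
  assumes X: "graph_bundle_with_fiber F X p G" and Y: "graph_bundle_with_fiber F' Y q G"
  shows "graph_bundle_with_fiber (cartesian_product F F')
           (subdirect_product G X p Y q) (subdirect_proj p q) G"
proof -
  note sX = graph_bundle_with_fiber_simple(1)[OF X] and sY = graph_bundle_with_fiber_simple(1)[OF Y]
    and sG = graph_bundle_with_fiber_simple(2)[OF X]
  note pX = graph_bundle_with_fiber_proj[OF X] and pY = graph_bundle_with_fiber_proj[OF Y]
  have lX: "unique_edge_lifting X p G" and lY: "unique_edge_lifting Y q G"
    and rX: "lifting_respects_fibers X p G" and rY: "lifting_respects_fibers Y q G"
    using X Y by (auto simp: graph_bundle_with_fiber_iff)
  let ?P = "subdirect_product G X p Y q" and ?r = "subdirect_proj p q"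
  \<comment> \<open>The first two kinds of edges stay inside a fiber, so over an edge of the
    loop-free base only the third kind is left.\<close>
  have adj_lift: "adj ?P (x, y) (x', y') \<longleftrightarrow> adj X x x' \<and> adj Y y y'"
    if "p x = q y" "p x' = q y'" "adj G (p x) (p x')" for x y x' y'
    using that adj_simple[OF sX] adj_simple[OF sY] adj_simple(3)[OF sG that(3)] by auto
  have "surj_graph_morphism ?r ?P G"
  proof -
    have "v \<in> ?r ` verts ?P" if v: "v \<in> verts G" for v
    proof -
      obtain x y where "x \<in> verts X" "p x = v" "y \<in> verts Y" "q y = v"
        using v pX(1) pY(1) by (metis imageE)
      then show ?thesis by (intro image_eqI[of _ _ "(x, y)"]) auto
    qed
    moreover have "?r ` verts ?P \<subseteq> verts G" unfolding pY(1)[symmetric] by auto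
    moreover have "adj G (?r a) (?r b) \<or> ?r a = ?r b" if "adj ?P a b" for a b
      using that pX(2) by (cases a; cases b) auto
    ultimately show ?thesis
      using simple_graph_subdirect_product[OF sX sY, of G p q] sG
      unfolding surj_graph_morphism_def graph_morphism_def by blast
  qed
  moreover have "unique_edge_lifting ?P ?r G"
    unfolding unique_edge_lifting_def
  proof (intro ballI allI impI)
    fix a w assume a: "a \<in> verts ?P" "adj G (?r a) w"
    obtain x y where eq: "a = (x, y)" by fastforce
    then have V: "x \<in> verts X" "y \<in> verts Y" "p x = q y" "adj G (p x) w" "adj G (q y) w"
      using a by auto
    obtain x' where x': "adj X x x'" "p x' = w" using unique_edge_lifting_ex[OF lX] V by metis
    obtain y' where y': "adj Y y y'" "q y' = w" using unique_edge_lifting_ex[OF lY] V by metis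
    show "\<exists>!b. adj ?P a b \<and> ?r b = w"
    proof (rule ex1I[of _ "(x', y')"])
      show "adj ?P a (x', y') \<and> ?r (x', y') = w"
        using adj_lift[of x y x' y'] V x' y' eq by simp
    next
      fix b assume b: "adj ?P a b \<and> ?r b = w"
      obtain u s where bu: "b = (u, s)" by fastforce
      then have us: "p u = w" "q s = w" using b eq by auto
      then have "adj X x u" "adj Y y s" using adj_lift[of x y u s] b bu eq V by auto
      then show "b = (x', y')"
        using unique_edge_lifting_unique[OF lX V(1), of x' u]
          unique_edge_lifting_unique[OF lY V(2), of y' s] us x' y' V bu by simp
    qed
  qed
  moreover have "lifting_respects_fibers ?P ?r G"
    unfolding lifting_respects_fibers_def
  proof (intro allI impI, elim conjE)
    fix a b a' b'
    assume h: "adj G (?r a) (?r a')" "?r b = ?r a" "?r b' = ?r a'" "adj ?P a a'" "adj ?P b b'"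
    obtain x y x' y' where eqa: "a = (x, y)" "a' = (x', y')" by fastforce
    obtain u s u' s' where eqb: "b = (u, s)" "b' = (u', s')" by fastforce
    have V: "x \<in> verts X" "u \<in> verts X" "y \<in> verts Y" "s \<in> verts Y"
        "x' \<in> verts X" "u' \<in> verts X" "y' \<in> verts Y" "s' \<in> verts Y"
      and e: "q y = p x" "p u = p x" "q s = p x" "q y' = p x'" "p u' = p x'" "q s' = p x'"
      and g: "adj G (p x) (p x')" "adj G (p x') (p x)"
      using h eqa eqb by (auto simp: adj_sym)
    have A: "adj X x x'" "adj X u u'" "adj Y y y'" "adj Y s s'"
      using adj_lift[of x y x' y'] adj_lift[of u s u' s'] h eqa eqb e g by auto
    then have A': "adj X x' x" "adj X u' u" "adj Y y' y" "adj Y s' s" by (simp_all add: adj_sym)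
    have "adj X x u \<longleftrightarrow> adj X x' u'" "adj Y y s \<longleftrightarrow> adj Y y' s'"
      using rX[unfolded lifting_respects_fibers_def, rule_format, of x x' u u']
        rY[unfolded lifting_respects_fibers_def, rule_format, of y y' s s'] A e g by auto
    \<comment> \<open>Adjacency inside a fiber of the product involves equality of one coordinate,
      so equality must be carried along as well: forward by unique lifting from \<open>x\<close>,
      backward by unique lifting from \<open>x'\<close> along the reversed edge.\<close>
    moreover have "x = u \<longleftrightarrow> x' = u'"
      using unique_edge_lifting_unique[OF lX V(1), of x' u']
        unique_edge_lifting_unique[OF lX V(5), of x u] A A' e g by auto
    moreover have "y = s \<longleftrightarrow> y' = s'"
      using unique_edge_lifting_unique[OF lY V(3), of y' s']
        unique_edge_lifting_unique[OF lY V(7), of y s] A A' e g by auto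
    \<comment> \<open>Rules out edges of the third kind between \<open>a\<close> and
      \<open>b\<close> and between \<open>a'\<close> and \<open>b'\<close>, as each pair shares a
      fiber.\<close>
    moreover have "\<not> adj G (p x) (p x)" "\<not> adj G (p x') (p x')"
      using adj_simple(3)[OF sG] by blast+
    ultimately show "adj ?P a b \<longleftrightarrow> adj ?P a' b'"
      using V e eqa eqb by auto
  qed
  moreover have "simple_graph (cartesian_product F F')" "finite (verts (cartesian_product F F'))"
    using X Y simple_graph_cartesian_product by (auto simp: graph_bundle_with_fiber_iff)
  moreover have "\<forall>v\<in>verts G. isomorphic_graphs (fiber ?P ?r v) (cartesian_product F F')"
    using X Y
    by (auto simp: graph_bundle_with_fiber_iff intro!: fiber_subdirect_product_isomorphic sX sY sG)
  ultimately show ?thesis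
    unfolding graph_bundle_with_fiber_iff by blast
qed

text \<open>Each edge of the base is its own only lift. Fibers are single vertices, so respecting
  adjacency inside them only compares loops, which a simple graph lacks.\<close>

lemma graph_bundle_with_fiber_id:
  assumes "simple_graph G"
  shows "graph_bundle_with_fiber \<lparr>verts = {()}, edges = {}\<rparr> G id G"
proof -
  let ?F = "\<lparr>verts = {()}, edges = {}\<rparr>"
  note adj_irrefl = adj_simple(3)[OF assms]
  have sF: "simple_graph ?F" by (simp add: simple_graph_def)
  have "isomorphic_graphs (fiber G id v) ?F" if "v \<in> verts G" for v
  proof -
    have "\<not> adj ?F () ()" by (simp add: adj_def)
    then have "graph_iso (\<lambda>_. ()) (fiber G id v) ?F"
      using that sF simple_graph_fiber[OF assms, of id v] adj_irrefl
      by (auto simp: graph_iso_def bij_betw_def inj_on_def)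
    then show ?thesis by (auto simp: isomorphic_graphs_def)
  qed
  moreover have "surj_graph_morphism id G G"
    using assms by (auto simp: surj_graph_morphism_def graph_morphism_def)
  moreover have "unique_edge_lifting G id G"
    by (auto simp: unique_edge_lifting_def)
  moreover have "lifting_respects_fibers G id G"
    using adj_irrefl by (auto simp: lifting_respects_fibers_def)
  ultimately show ?thesis
    using sF by (simp add: graph_bundle_with_fiber_iff)
qed

section \<open>Commutativity, associativity and the neutral element\<close>

lemma subdirect_product_commute:
  assumes X: "graph_bundle_with_fiber F X p G" and Y: "graph_bundle_with_fiber F' Y q G"
  shows "bundle_equivalent G (subdirect_product G X p Y q) (subdirect_proj p q)
           (subdirect_product G Y q X p) (subdirect_proj q p)"
proof -
  note XY = graph_bundle_with_fiber_subdirect_product[OF X Y]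
    and YX = graph_bundle_with_fiber_subdirect_product[OF Y X]
  let ?P = "subdirect_product G X p Y q" and ?Q = "subdirect_product G Y q X p"
  have "bij_betw prod.swap (verts ?P) (verts ?Q)"
    by (rule bij_betw_byWitness[where f' = prod.swap]) auto
  \<comment> \<open>Swapping exchanges the first two kinds of edges. Only the second mentions that
    the edge stays in a fiber, but in the first this follows from \<open>x = x'\<close> and the
    agreement of the projections on vertices.\<close>
  moreover have "adj ?P a b \<longleftrightarrow> adj ?Q (prod.swap a) (prod.swap b)" for a b
    by (cases a; cases b) auto
  ultimately have "graph_iso prod.swap ?P ?Q"
    using graph_bundle_with_fiber_simple(1)[OF XY] graph_bundle_with_fiber_simple(1)[OF YX]
    by (simp add: graph_iso_def)
  then show ?thesis
    unfolding bundle_equivalent_def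
    using graph_bundle_if_graph_bundle_with_fiber[OF XY]
      graph_bundle_if_graph_bundle_with_fiber[OF YX]
    by (auto intro!: exI[of _ prod.swap])
qed

text \<open>With either bracketing, an edge moves exactly one of the three coordinates, inside its
  fiber, or all three over an edge of the base. The mixed cases that nesting the definition produces
  would force a loop in the base, whence \<open>irrefl\<close>.\<close>

lemma subdirect_product_assoc:
  assumes X: "graph_bundle_with_fiber F X p G" and Y: "graph_bundle_with_fiber F' Y q G"
    and Z: "graph_bundle_with_fiber F'' Z r G"
  shows "bundle_equivalent G
           (subdirect_product G (subdirect_product G X p Y q) (subdirect_proj p q) Z r)
           (subdirect_proj (subdirect_proj p q) r)
           (subdirect_product G X p (subdirect_product G Y q Z r) (subdirect_proj q r))
           (subdirect_proj p (subdirect_proj q r))"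
proof -
  note L = graph_bundle_with_fiber_subdirect_product[OF
      graph_bundle_with_fiber_subdirect_product[OF X Y] Z]
    and R = graph_bundle_with_fiber_subdirect_product[OF X
      graph_bundle_with_fiber_subdirect_product[OF Y Z]]
  let ?P = "subdirect_product G (subdirect_product G X p Y q) (subdirect_proj p q) Z r"
    and ?Q = "subdirect_product G X p (subdirect_product G Y q Z r) (subdirect_proj q r)"
    and ?f = "\<lambda>((x, y), z). (x, (y, z))"
  have irrefl: "\<not> adj G v v" for v
    using adj_simple(3)[OF graph_bundle_with_fiber_simple(2)[OF X]] by blast
  have "bij_betw ?f (verts ?P) (verts ?Q)"
    by (rule bij_betw_byWitness[where f' = "\<lambda>(x, (y, z)). ((x, y), z)"]) auto
  moreover have "adj ?P a b \<longleftrightarrow> adj ?Q (?f a) (?f b)" for a b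
  proof -
    obtain x y z x' y' z' where "a = ((x, y), z)" "b = ((x', y'), z')"
      by (metis surj_pair)
    then show ?thesis using irrefl by auto
  qed
  ultimately have "graph_iso ?f ?P ?Q"
    using graph_bundle_with_fiber_simple(1)[OF L] graph_bundle_with_fiber_simple(1)[OF R]
    by (simp add: graph_iso_def)
  then show ?thesis
    unfolding bundle_equivalent_def
    using graph_bundle_if_graph_bundle_with_fiber[OF L]
      graph_bundle_if_graph_bundle_with_fiber[OF R]
    by (auto intro!: exI[of _ ?f])
qed

text \<open>The second coordinate of a vertex is \<open>p x\<close>, so \<open>fst\<close> has the
  inverse \<open>\<lambda>x. (x, p x)\<close>. An edge of the first kind would be a loop in the
  base; the other two kinds are the edges of \<open>X\<close> inside a fiber and over a base edge,
  and as \<open>p\<close> is a morphism these are all edges of \<open>X\<close>.\<close>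

lemma subdirect_product_id_right:
  assumes X: "graph_bundle_with_fiber F X p G"
  shows "bundle_equivalent G (subdirect_product G X p G id) (subdirect_proj p id) X p"
proof -
  note sX = graph_bundle_with_fiber_simple(1)[OF X] and sG = graph_bundle_with_fiber_simple(2)[OF X]
  note pX = graph_bundle_with_fiber_proj[OF X]
  note P = graph_bundle_with_fiber_subdirect_product[OF X graph_bundle_with_fiber_id[OF sG]]
  let ?P = "subdirect_product G X p G id"
  have "bij_betw fst (verts ?P) (verts X)"
    by (rule bij_betw_byWitness[where f' = "\<lambda>x. (x, p x)"]) (use pX(1) in auto)
  moreover have "adj ?P a b \<longleftrightarrow> adj X (fst a) (fst b)" if "a \<in> verts ?P" "b \<in> verts ?P" for a b
    using that pX(2) adj_simple(3)[OF sG] by (cases a; cases b) auto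
  ultimately have "graph_iso fst ?P X"
    using graph_bundle_with_fiber_simple(1)[OF P] sX by (simp add: graph_iso_def)
  then show ?thesis
    unfolding bundle_equivalent_def
    using graph_bundle_if_graph_bundle_with_fiber[OF P]
      graph_bundle_if_graph_bundle_with_fiber[OF X]
    by (auto intro!: exI[of _ fst])
qed

theorem theorem4p9:
  fixes \<Gamma> :: "'v graph"
    and X1 :: "'a graph" and X2 :: "'b graph" and X3 :: "'c graph"
    and p1 :: "'a \<Rightarrow> 'v" and p2 :: "'b \<Rightarrow> 'v" and p3 :: "'c \<Rightarrow> 'v"
    and F1 :: "'f graph" and F2 :: "'g graph" and F3 :: "'h graph"
  assumes "simple_graph \<Gamma>"
    and "graph_bundle_with_fiber F1 X1 p1 \<Gamma>"
    and "graph_bundle_with_fiber F2 X2 p2 \<Gamma>"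
    and "graph_bundle_with_fiber F3 X3 p3 \<Gamma>"
  shows "bundle_equivalent \<Gamma>
           (subdirect_product \<Gamma> X1 p1 X2 p2) (subdirect_proj p1 p2)
           (subdirect_product \<Gamma> X2 p2 X1 p1) (subdirect_proj p2 p1)
       \<and> bundle_equivalent \<Gamma>
           (subdirect_product \<Gamma> (subdirect_product \<Gamma> X1 p1 X2 p2) (subdirect_proj p1 p2) X3 p3)
           (subdirect_proj (subdirect_proj p1 p2) p3)
           (subdirect_product \<Gamma> X1 p1 (subdirect_product \<Gamma> X2 p2 X3 p3) (subdirect_proj p2 p3))
           (subdirect_proj p1 (subdirect_proj p2 p3))
       \<and> bundle_equivalent \<Gamma>
           (subdirect_product \<Gamma> X1 p1 \<Gamma> id) (subdirect_proj p1 id)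
           X1 p1"
  using assms(2-4)
  by (intro conjI subdirect_product_commute subdirect_product_assoc subdirect_product_id_right)

end
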